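(* Let $b>1$ and $d\ge 1$ be integers, let $u\in\mathbb{N}\cup\{\infty\}$, let $\mathbb{M}$ be a set and let $P:[0,1)^d\to\mathbb{M}$ be a map. Let $(\mathscr{D},f)$ be an admissible function-pair, i.e. $\mathscr{D}:\mathcal{E}_{\mathbb{M}}\to\mathbb{R}$ is $f$-subadditive over the set $\mathcal{E}_{\mathbb{M}}$ of empirical measures on $\mathbb{M}$. Let the pair $(L_m,\mathscr{Z}^u)$ have one of the following two meanings, for integers $0\le m\le u$: (1) $L_m=\{\ell^d_{b^m}\}$, where $\ell^d_{b^m}=(b^{-m}\mathbb{Z}^d)\cap[0,1)^d$, and $\mathscr{Z}^u$ is the set of all initial segments of length $b^{ud}$ (the whole sequences if $u=\infty$) of the sequences $P(S^\Box_{b,d})$, where $S^\Box_{b,d}$ runs through all $S^\Box_{b,d}$-sequences; (2) $L_m$ is the set of all perturbed lattice sets $\omega\subset[0,1)^d$ of resolution $b^m$, and $\mathscr{Z}^u$ is the set of all initial segments of length $b^{ud}$ (the whole sequences if $u=\infty$) of the sequences $P(S^\boxplus_{b,d})$, where $S^\boxplus_{b,d}$ runs through all $S^\Box_{b,d}$-guided sequences (for all choices of $S^\Box_{b,d}$). For $k\in\mathbb{N}\cup\{0\}$ set $W_m^{k,b}=[0,b^{-m})^d\cap(b^{-k-1}\mathbb{Z}^d)$ and $W_m^{\infty,b}=\bigcup_{k=0}^\infty W_m^{k,b}$. For $\star\in\mathbb{N}\cup\{0,\infty\}$ set $\Omega_m^\star=\{(\omega,v)\in L_m\times W_m^{\star,b}: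 \omega+v\subset[0,1)^d\}$ and $$h_m^\star:=\sup_{(\omega,v)\in\Omega_m^\star}\mathscr{D}\big(E_{P(\omega+v)}\big),$$ so that $h_m^k\le h_m^\infty$. Let $N\in\mathbb{N}$ with $N<b^{ud}$ have $b^d$-adic expansion $N=\sum_{j=0}^n\epsilon_jb^{dj}$ (with $\epsilon_j\in\{0,\dots,b^d-1\}$, $\epsilon_n\neq 0$). Then for every $Z\in\mathscr{Z}^u$, with $Z_N$ the multiset of the first $N$ elements of $Z$, $$\mathscr{D}(E_{Z_N})\ \le\ f\Big(\sum_{j=0}^n\epsilon_j\Big)\cdot\sum_{j=0}^n\epsilon_jh_j^n\ \le\ f\Big(\sum_{j=0}^n\epsilon_j\Big)\cdot\sum_{j=0}^n\epsilon_jh_j^\infty .$$ If, additionally, $\mathscr{D}$ is defined and $f$-subadditive over $\{\nu_1-\nu_2:\nu_1,\nu_2\in\mathcal{E}_{\mathbb{M}}\}$, in the sense that $\mathscr{D}$ is real-valued on this set and $$\mathscr{D}\Big(\sum_{j=1}^{r}\nu_j-\sum_{j=1}^{k}\mu_j\Big)\le f(r+k)\sum_{j=1}^{r}\mathscr{D}(\nu_j)+f(r+k)\sum_{j=1}^{k}\mathscr{D}(\mu_j)$$ for all $r,k\in\mathbb{N}$ and all $\nu_j,\mu_j\in\mathcal{E}_{\mathbb{M}}$, then (note that $N=b^{(n+1)d}-N'$ with $N'=1+\sum_{j=0}^n(b^d-1-\epsilon_j)b^{dj}$) for every $Z\in\mathscr{Z}^u$ $$\mathscr{D}(E_{Z_N})\le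 f\Big(2+\sum_{j=0}^n(b^d-1-\epsilon_j)\Big)\cdot\Big(h_{n+1}^n+h_0^n+\sum_{j=0}^n(b^d-1-\epsilon_j)h_j^n\Big).$$
   Context: $\mathbb{N}=\{1,2,\dots\}$. Suprema are taken in the extended reals, with $0\cdot\infty=0$. **Empirical measures and admissible pairs.** For a finite nonempty multiset $W=\{w_1,\dots,w_N\}$ in $\mathbb{M}$, $E_W=\sum_{j=1}^N\delta(w_j)$ where $\delta(x)$ is the Dirac measure at $x$ (no normalization). $\mathcal{E}_{\mathbb{M}}$ is the set of all such $E_W$. For $f:\mathbb{N}\to\mathbb{R}$, a function $\mathscr{D}:\mathcal{E}_{\mathbb{M}}\to\mathbb{R}$ is $f$-subadditive over $\mathcal{E}_{\mathbb{M}}$ if $\mathscr{D}(\sum_{j=1}^n\nu_j)\le f(n)\sum_{j=1}^n\mathscr{D}(\nu_j)$ for all $n\in\mathbb{N}$ and $\nu_1,\dots,\nu_n\in\mathcal{E}_{\mathbb{M}}$; the pair $(\mathscr{D},f)$ is then called admissible. For a set $M\subset[0,1)^d$, $P(M)$ is understood as a multiset (images counted with multiplicity). For a sequence $S=(s_0,s_1,\dots)$ in $[0,1)^d$, $P(S)=(z_1,z_2,\dots)$ with $z_{j+1}=P(s_j)$. **Perturbed lattice sets.** A set $\omega\subset[0,1)^d$ with $|\omega|=K^d$ is a perturbed lattice set of resolution $K\in\mathbb{N}$ if $|\omega\cap(q+\frac1K[0,1)^d)|=1$ for every $q\in\ell^d_K=(\frac1K\mathbb{Z}^d)\cap[0,1)^d$.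 **$S^\Box_{b,d}$-sequences.** Fix an enumeration $\{H_1,\dots,H_{b^d-1}\}=\{0,\dots,b-1\}^d\setminus\{\vec0\}$ and a sequence $\pi_0,\pi_1,\pi_2,\dots$ of permutations of $\{1,\dots,b^d-1\}$. Define $S=(s_0,s_1,\dots)$ in $[0,1)^d$ recursively: $s_0=\vec0$; if $s_0,\dots,s_{b^{dm}-1}$ are defined ($m\ge0$), set $s_{k\cdot b^{dm}+i}=b^{-m-1}H_{\pi_m(k)}+s_i$ for $1\le k\le b^d-1$ and $0\le i<b^{dm}$. Any sequence obtained in this way is an $S^\Box_{b,d}$-sequence. **Guided sequences.** Given an $S^\Box_{b,d}$-sequence $(s_0,s_1,\dots)$, a sequence $S^\boxplus_{b,d}=(q_0,q_1,\dots)$ in $[0,1)^d$ is $S^\Box_{b,d}$-guided if $q_0\in[0,1)^d$ is arbitrary and for every integer $m\ge0$: (i) for all $v\in(b^{-m-1}\mathbb{Z}^d)\cap[0,1)^d$, $|\{q_0,\dots,q_{b^{d(m+1)}-1}\}\cap(b^{-(m+1)}[0,1)^d+v)|=1$; (ii) for every $0\le r<b^{dm}$ and $1\le k<b^d$, $q_{r+k\cdot b^{dm}}\in s_r+b^{-m}[0,1)^d$.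
   Formalization: The function f is additionally assumed nonnegative on the positive integers; for f with negative values the second inequality can fail (e.g. b=2, d=1, P=id, f=-1, D=-1 at the Dirac measure at 3/8 and D=-2 elsewhere, N=1). *)

theory Defs
  imports
    "HOL-Analysis.Analysis"
    "HOL-Library.Multiset"
    "HOL-Library.Function_Algebras"
begin

text \<open>
  The dimension \<open>d\<close> is \<^term>\<open>CARD('d)\<close> for points of type \<^typ>\<open>real^'d\<close>, and the target
  set of \<open>P\<close> is the type \<open>'m\<close>. The library has no signed measures, so a finite signed measure
  on the power set of \<open>'m\<close> is the real-valued set function of type \<^typ>\<open>'m set \<Rightarrow> real\<close> that
  it is; sums and differences of measures are the pointwise ones.
\<close>

definition dirac :: "'m \<Rightarrow> 'm set \<Rightarrow> real" where
  "dirac x = (\<lambda>A. indicator A x)"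

definition emp :: "'m multiset \<Rightarrow> 'm set \<Rightarrow> real" where
  "emp W = (\<Sum>w\<in>#W. dirac w)"

definition emp_measures :: "('m set \<Rightarrow> real) set" where
  "emp_measures = {emp W | W. W \<noteq> {#}}"

text \<open>
  The functional is a total function here; only its values on \<^const>\<open>emp_measures\<close>
  (respectively on differences of such measures) are constrained, and only values of \<open>f\<close> at
  positive integers matter.
\<close>

definition f_subadditive :: "(nat \<Rightarrow> real) \<Rightarrow> (('m set \<Rightarrow> real) \<Rightarrow> real) \<Rightarrow> bool" where
  "f_subadditive f D \<longleftrightarrow>
    (\<forall>n\<ge>1. \<forall>\<nu>. (\<forall>j\<in>{1..n}. \<nu> j \<in> emp_measures) \<longrightarrow>
      D (\<Sum>j=1..n. \<nu> j) \<le> f n * (\<Sum>j=1..n. D (\<nu> j)))"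

definition f_subadditive_diff :: "(nat \<Rightarrow> real) \<Rightarrow> (('m set \<Rightarrow> real) \<Rightarrow> real) \<Rightarrow> bool" where
  "f_subadditive_diff f D \<longleftrightarrow>
    (\<forall>r\<ge>1. \<forall>k\<ge>1. \<forall>\<nu> \<mu>.
      (\<forall>j\<in>{1..r}. \<nu> j \<in> emp_measures) \<longrightarrow> (\<forall>j\<in>{1..k}. \<mu> j \<in> emp_measures) \<longrightarrow>
      D ((\<Sum>j=1..r. \<nu> j) - (\<Sum>j=1..k. \<mu> j))
        \<le> f (r + k) * (\<Sum>j=1..r. D (\<nu> j)) + f (r + k) * (\<Sum>j=1..k. D (\<mu> j)))"

definition half_open_cube :: "real \<Rightarrow> (real^'d) set" where
  "half_open_cube a = {x. \<forall>i. 0 \<le> x $ i \<and> x $ i < a}"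

definition fine_grid :: "nat \<Rightarrow> (real^'d) set" where
  "fine_grid K = {x. \<forall>i. \<exists>z::int. x $ i = of_int z / real K}"

definition cube_lattice :: "nat \<Rightarrow> (real^'d) set" where
  "cube_lattice K = fine_grid K \<inter> half_open_cube 1"

definition perturbed_lattice :: "nat \<Rightarrow> (real^'d) set \<Rightarrow> bool" where
  "perturbed_lattice K \<omega> \<longleftrightarrow>
    \<omega> \<subseteq> half_open_cube 1 \<and> card \<omega> = K ^ CARD('d) \<and>
    (\<forall>q\<in>cube_lattice K. card (\<omega> \<inter> (+) q ` half_open_cube (1 / real K)) = 1)"

definition digit_vectors :: "nat \<Rightarrow> (real^'d) set" where
  "digit_vectors b = {x. \<forall>i. \<exists>a<b. x $ i = real a}"

definition box_seq :: "nat \<Rightarrow> (nat \<Rightarrow> real^'d) \<Rightarrow> bool" where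
  "box_seq b s \<longleftrightarrow>
    (\<exists>(H :: nat \<Rightarrow> real^'d) (\<pi> :: nat \<Rightarrow> nat \<Rightarrow> nat).
      bij_betw H {1..b ^ CARD('d) - 1} (digit_vectors b - {0}) \<and>
      (\<forall>m. \<pi> m permutes {1..b ^ CARD('d) - 1}) \<and>
      s 0 = 0 \<and>
      (\<forall>m. \<forall>k\<in>{1..b ^ CARD('d) - 1}. \<forall>i < b ^ (CARD('d) * m).
        s (k * b ^ (CARD('d) * m) + i) = (1 / real b ^ (m + 1)) *\<^sub>R H (\<pi> m k) + s i))"

definition guided_seq :: "nat \<Rightarrow> (nat \<Rightarrow> real^'d) \<Rightarrow> (nat \<Rightarrow> real^'d) \<Rightarrow> bool" where
  "guided_seq b s q \<longleftrightarrow>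
    (\<forall>j. q j \<in> half_open_cube 1) \<and>
    (\<forall>m. \<forall>v\<in>cube_lattice (b ^ (m + 1)).
      card (q ` {..<b ^ (CARD('d) * (m + 1))} \<inter> (+) v ` half_open_cube (1 / real b ^ (m + 1))) = 1) \<and>
    (\<forall>m. \<forall>r < b ^ (CARD('d) * m). \<forall>k. 1 \<le> k \<and> k < b ^ CARD('d) \<longrightarrow>
      q (r + k * b ^ (CARD('d) * m)) \<in> (+) (s r) ` half_open_cube (1 / real b ^ m))"

text \<open>The length \<open>b ^ (u d)\<close>, with value \<open>\<infinity>\<close> for \<open>u = \<infinity>\<close>.\<close>

definition seg_length :: "nat \<Rightarrow> nat \<Rightarrow> enat \<Rightarrow> enat" where
  "seg_length b d u = (case u of enat k \<Rightarrow> enat (b ^ (k * d)) | \<infinity> \<Rightarrow> \<infinity>)"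

text \<open>
  A finite or infinite sequence of length \<open>l\<close> is a function on the index set \<open>{i. i < l}\<close>,
  extensional outside of it. Index \<open>j\<close> holds the \<open>(j + 1)\<close>-st element.
\<close>

definition init_seg :: "enat \<Rightarrow> (nat \<Rightarrow> 'm) \<Rightarrow> nat \<Rightarrow> 'm" where
  "init_seg l z = restrict z {i. enat i < l}"

definition first_elems :: "nat \<Rightarrow> (nat \<Rightarrow> 'm) \<Rightarrow> 'm multiset" where
  "first_elems N Z = image_mset Z (mset_set {..<N})"

definition box_segments :: "nat \<Rightarrow> enat \<Rightarrow> (real^'d \<Rightarrow> 'm) \<Rightarrow> (nat \<Rightarrow> 'm) set" where
  "box_segments b u P = {init_seg (seg_length b CARD('d) u) (P \<circ> s) | s. box_seq b s}"

definition guided_segments :: "nat \<Rightarrow> enat \<Rightarrow> (real^'d \<Rightarrow> 'm) \<Rightarrow> (nat \<Rightarrow> 'm) set" where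
  "guided_segments b u P =
    {init_seg (seg_length b CARD('d) u) (P \<circ> q) | s q. box_seq b s \<and> guided_seq b s q}"

definition shifts :: "nat \<Rightarrow> nat \<Rightarrow> enat \<Rightarrow> (real^'d) set" where
  "shifts b m k =
    (case k of
      enat k' \<Rightarrow> half_open_cube (1 / real b ^ m) \<inter> fine_grid (b ^ (k' + 1))
    | \<infinity> \<Rightarrow> (\<Union>k'. half_open_cube (1 / real b ^ m) \<inter> fine_grid (b ^ (k' + 1))))"

definition Omega :: "nat \<Rightarrow> (nat \<Rightarrow> (real^'d) set set) \<Rightarrow> nat \<Rightarrow> enat
    \<Rightarrow> ((real^'d) set \<times> (real^'d)) set" where
  "Omega b L m k = {(\<omega>, v). \<omega> \<in> L m \<and> v \<in> shifts b m k \<and> (+) v ` \<omega> \<subseteq> half_open_cube 1}"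

definition h_sup :: "(('m set \<Rightarrow> real) \<Rightarrow> real) \<Rightarrow> (real^'d \<Rightarrow> 'm) \<Rightarrow> nat
    \<Rightarrow> (nat \<Rightarrow> (real^'d) set set) \<Rightarrow> nat \<Rightarrow> enat \<Rightarrow> ereal" where
  "h_sup D P b L m k =
    (SUP (\<omega>, v) \<in> Omega b L m k. ereal (D (emp (image_mset P (mset_set ((+) v ` \<omega>))))))"

end

theory Submission
  imports Defs
begin

text \<open>
  Put \<open>B = b^d\<close>, and call \<open>{A..<A + B^j}\<close> with \<open>B^j dvd A\<close> a block of level \<open>j\<close>. Both
  inequalities come from one fact: the terms with index in a block of level \<open>j\<close> below \<open>B^(n+1)\<close>
  are the images under \<open>P\<close> of a translate \<open>\<omega> + v\<close> of a set \<open>\<omega>\<close> in \<open>L j\<close> by an admissible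
  shift \<open>v\<close>, so that \<open>D\<close> of their empirical measure is at most \<open>h j n\<close>
  (\<open>block_value_le_h_sup\<close>).

  For a box sequence \<open>s\<close> the fact holds because \<open>s\<close> is additive without carries,
  \<open>s (A + i) = s A + s i\<close> for \<open>i < B^j\<close> (\<open>box_seq_shift\<close>), and because its first \<open>B^j\<close> terms
  run through the lattice of resolution \<open>b^j\<close> once (\<open>box_seq_bij_betw_cube_lattice\<close>). Thus \<open>v = s A\<close>,
  and this point is small since only digits from position \<open>j\<close> on occur in \<open>A\<close> (\<open>box_seq_bounds\<close>). For a
  guided sequence \<open>q\<close> one may take \<open>v = 0\<close>: the term \<open>q (A + i)\<close> lies in the cell with corner \<open>s i\<close>,
  which makes the whole block a perturbed lattice set (\<open>guided_seq_block_perturbed_lattice\<close>).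

  It remains to cut intervals into blocks. The digits of \<open>N\<close> cut \<open>{0..<N}\<close> into \<open>\<epsilon> j\<close> blocks of
  each level \<open>j\<close>, the longest ones first, and subadditivity gives the first inequality
  (\<open>digit_block_estimate\<close>). For the second one, \<open>{0..<N}\<close> is the single block \<open>{0..<B^(n+1)}\<close>
  minus \<open>{N..<B^(n+1)}\<close>, and the latter is filled from below, the shortest blocks first: one
  block of length 1, then \<open>B - 1 - \<epsilon> j\<close> blocks of level \<open>j\<close> for \<open>j = 0, ..., n\<close>
  (\<open>complementary_digit_block_estimate\<close>).
\<close>

section \<open>Lattice cells\<close>

lemma fine_gridE:
  fixes x :: "real^'d"
  assumes "x \<in> fine_grid K"
  obtains z :: "'d \<Rightarrow> int" where "\<And>i. x $ i = of_int (z i) / real K"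
proof -
  have "\<forall>i. \<exists>z::int. x $ i = of_int z / real K"
    using assms by (simp add: fine_grid_def)
  then have "\<exists>z. \<forall>i. x $ i = of_int (z i :: int) / real K" by (rule choice)
  then show thesis using that by blast
qed

lemma cube_lattice_1:
  assumes "x \<in> cube_lattice 1"
  shows "x = 0"
proof -
  obtain z :: "'a \<Rightarrow> int" where z: "\<And>i. x $ i = of_int (z i) / real 1"
    using assms fine_gridE unfolding cube_lattice_def by blast
  have "0 \<le> x $ i \<and> x $ i < 1" for i
    using assms by (auto simp: cube_lattice_def half_open_cube_def)
  then have z01: "0 \<le> z i \<and> z i < 1" for i by (simp add: z)
  have "x $ i = 0" for i using z01[of i] z[of i] by simp
  then show ?thesis by (simp add: vec_eq_iff)
qed

lemma card_cube_lattice: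
  assumes "K > 0"
  shows "card (cube_lattice K :: (real^'d) set) = K ^ CARD('d)"
proof -
  let ?g = "\<lambda>a :: 'd \<Rightarrow> nat. (\<chi> i. real (a i) / real K) :: real^'d"
  let ?F = "UNIV \<rightarrow>\<^sub>E {..<K} :: ('d \<Rightarrow> nat) set"
  have "inj_on ?g ?F"
  proof (rule inj_onI)
    fix a a' :: "'d \<Rightarrow> nat"
    assume "?g a = ?g a'"
    then have "real (a i) / real K = real (a' i) / real K" for i
      by (metis vec_lambda_beta)
    then show "a = a'" using assms by (auto simp: fun_eq_iff)
  qed
  moreover have "?g ` ?F = cube_lattice K"
  proof (intro equalityI subsetI)
    fix x assume "x \<in> ?g ` ?F"
    then obtain a where a: "a \<in> ?F" "x = ?g a" by auto
    then have "a i < K" for i by auto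
    moreover have "\<exists>z::int. x $ i = of_int z / real K" for i
      using a by (intro exI[of _ "int (a i)"]) simp
    ultimately show "x \<in> cube_lattice K"
      using a assms by (auto simp: cube_lattice_def fine_grid_def half_open_cube_def)
  next
    fix x :: "real^'d" assume x: "x \<in> cube_lattice K"
    then obtain z :: "'d \<Rightarrow> int" where z: "\<And>i. x $ i = of_int (z i) / real K"
      using fine_gridE by (auto simp: cube_lattice_def)
    have z0: "0 \<le> z i \<and> z i < int K" for i
    proof -
      have "0 \<le> x $ i" "x $ i < 1"
        using x by (auto simp: cube_lattice_def half_open_cube_def)
      then have "0 \<le> real_of_int (z i)" "real_of_int (z i) < real_of_int (int K)"
        using assms by (simp_all add: z zero_le_divide_iff)
      then show ?thesis by linarith
    qed
    have "x = ?g (\<lambda>i. nat (z i))"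
      using z0 z by (auto simp: vec_eq_iff)
    moreover have "(\<lambda>i. nat (z i)) \<in> ?F"
      using z0 by (auto simp: nat_less_iff)
    ultimately show "x \<in> ?g ` ?F" by (rule image_eqI)
  qed
  ultimately have "card (cube_lattice K :: (real^'d) set) = card ?F"
    by (metis card_image)
  then show ?thesis by (simp add: card_PiE)
qed

lemma mem_cell_iff:
  "x \<in> (+) c ` half_open_cube a \<longleftrightarrow> (\<forall>i. c $ i \<le> x $ i \<and> x $ i < c $ i + a)"
proof
  assume "\<forall>i. c $ i \<le> x $ i \<and> x $ i < c $ i + a"
  then have "x - c \<in> half_open_cube a"
    by (auto simp: half_open_cube_def algebra_simps)
  then show "x \<in> (+) c ` half_open_cube a"
    by (intro image_eqI[of _ _ "x - c"]) auto
qed (auto simp: half_open_cube_def)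

text \<open>
  The corner of the cell that contains \<open>x\<close> is recovered from \<open>x\<close> by rounding down the
  coordinates of \<open>K x\<close>.
\<close>
lemma lattice_cells_disjoint:
  fixes c c' x :: "real^'d"
  assumes "K > 0" "c \<in> cube_lattice K" "c' \<in> cube_lattice K"
    and "x \<in> (+) c ` half_open_cube (1 / real K)" "x \<in> (+) c' ` half_open_cube (1 / real K)"
  shows "c = c'"
proof -
  have *: "c $ i = of_int \<lfloor>real K * x $ i\<rfloor> / real K"
    if c: "c \<in> cube_lattice K" "x \<in> (+) c ` half_open_cube (1 / real K)" for c :: "real^'d" and i
  proof -
    obtain z :: int where z: "c $ i = of_int z / real K"
      using c by (auto simp: cube_lattice_def fine_grid_def)
    have "c $ i \<le> x $ i" "x $ i < c $ i + 1 / real K"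
      using c unfolding mem_cell_iff by auto
    then have "of_int z \<le> real K * x $ i" "real K * x $ i < of_int z + 1"
      using assms(1) by (auto simp: z field_simps)
    then show ?thesis using z by (simp add: floor_unique)
  qed
  show ?thesis
    using *[OF assms(2,4)] *[OF assms(3,5)] by (simp add: vec_eq_iff)
qed

text \<open>
  Points chosen from pairwise distinct cells, all cells being used, meet each cell exactly once
  because different cells are disjoint.
\<close>
lemma perturbed_lattice_of_cell_points:
  fixes c g :: "'i \<Rightarrow> real^'d"
  assumes "K > 0" and c: "bij_betw c I (cube_lattice K)"
    and g: "\<And>i. i \<in> I \<Longrightarrow> g i \<in> half_open_cube 1"
      "\<And>i. i \<in> I \<Longrightarrow> g i \<in> (+) (c i) ` half_open_cube (1 / real K)"
  shows "perturbed_lattice K (g ` I)" and "inj_on g I"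
proof -
  have cell: "i = j"
    if "i \<in> I" "j \<in> I" "g i \<in> (+) (c j) ` half_open_cube (1 / real K)" for i j
  proof -
    have "c i = c j"
      using that c by (intro lattice_cells_disjoint[OF assms(1) _ _ g(2)])
        (auto simp: bij_betw_def)
    then show ?thesis using c that by (auto simp: bij_betw_def inj_on_def)
  qed
  show inj: "inj_on g I"
    using cell g(2) by (metis inj_onI)
  have "g ` I \<inter> (+) q ` half_open_cube (1 / real K) = {g i}" if "i \<in> I" "q = c i" for i q
    using that cell g(2) by blast
  then have "card (g ` I \<inter> (+) q ` half_open_cube (1 / real K)) = 1"
    if "q \<in> cube_lattice K" for q
    using that c by (metis bij_betw_imp_surj_on card_1_singleton_iff imageE One_nat_def)
  moreover have "card (g ` I) = K ^ CARD('d)"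
    using card_image[OF inj] bij_betw_same_card[OF c] card_cube_lattice[OF assms(1), where 'd='d]
    by simp
  ultimately show "perturbed_lattice K (g ` I)"
    using g(1) by (auto simp: perturbed_lattice_def)
qed

text \<open>
  Condition (i) on guided sequences speaks of the set of the first terms only. This count turns it into
  injectivity: a set that meets all cells has at least as many elements as there are indices.
\<close>
lemma card_ge_of_cells_met:
  fixes \<omega> :: "(real^'d) set"
  assumes "K > 0" "finite \<omega>"
    and "\<And>c. c \<in> cube_lattice K \<Longrightarrow> card (\<omega> \<inter> (+) c ` half_open_cube (1 / real K)) = 1"
  shows "K ^ CARD('d) \<le> card \<omega>"
proof -
  have "\<forall>c\<in>cube_lattice K. \<exists>x. x \<in> \<omega> \<inter> (+) c ` half_open_cube (1 / real K)"
    using assms(3) by (metis One_nat_def card_1_singletonE insertI1)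
  then obtain g where g: "\<And>c. c \<in> cube_lattice K \<Longrightarrow> g c \<in> \<omega> \<inter> (+) c ` half_open_cube (1 / real K)"
    by metis
  have "inj_on g (cube_lattice K)"
    using g lattice_cells_disjoint[OF assms(1)] by (metis IntD2 inj_onI)
  then have "card (cube_lattice K :: (real^'d) set) \<le> card \<omega>"
    using g assms(2) by (intro card_inj_on_le) auto
  then show ?thesis by (simp add: card_cube_lattice assms(1))
qed


section \<open>Arithmetic of box sequences\<close>

text \<open>
  Step \<open>m\<close> runs through the nonzero digit vectors in an order of its own; here \<open>a m\<close> is the enumeration
  \<open>H\<close> composed with the permutation \<open>\<pi> m\<close>.
\<close>
lemma box_seqE:
  fixes s :: "nat \<Rightarrow> real^'d"
  assumes "box_seq b s"
  obtains a where "\<And>m. bij_betw (a m) {1..b ^ CARD('d) - 1} (digit_vectors b - {0})"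
    and "\<And>m k i. k \<in> {1..b ^ CARD('d) - 1} \<Longrightarrow> i < (b ^ CARD('d)) ^ m \<Longrightarrow>
      s (k * (b ^ CARD('d)) ^ m + i) = (1 / real b ^ Suc m) *\<^sub>R a m k + s i"
proof -
  let ?K = "{1..b ^ CARD('d) - 1}"
  obtain H :: "nat \<Rightarrow> real^'d" and \<pi> :: "nat \<Rightarrow> nat \<Rightarrow> nat" where
    H: "bij_betw H ?K (digit_vectors b - {0})" and \<pi>: "\<And>m. \<pi> m permutes ?K" and
    s: "\<forall>m. \<forall>k\<in>?K. \<forall>i < b ^ (CARD('d) * m).
        s (k * b ^ (CARD('d) * m) + i) = (1 / real b ^ (m + 1)) *\<^sub>R H (\<pi> m k) + s i"
    using assms unfolding box_seq_def by blast
  show thesis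
  proof
    show "bij_betw (H \<circ> \<pi> m) ?K (digit_vectors b - {0})" for m
      using permutes_imp_bij[OF \<pi>] H by (rule bij_betw_trans)
  next
    fix m k i assume "k \<in> ?K" "i < (b ^ CARD('d)) ^ m"
    then show "s (k * (b ^ CARD('d)) ^ m + i) = (1 / real b ^ Suc m) *\<^sub>R (H \<circ> \<pi> m) k + s i"
      using s[rule_format, of k i m] by (simp add: power_mult)
  qed
qed

lemma box_seq_0: "box_seq b s \<Longrightarrow> s 0 = 0"
  by (auto simp: box_seq_def)

text \<open>
  The digit \<open>k = A div B^m\<close> may vanish here; the digit vector is then \<open>0\<close>. This uniform form makes
  the inductions on \<open>m\<close> below free of case distinctions.
\<close>
lemma box_seq_leading_digit:
  fixes s :: "nat \<Rightarrow> real^'d"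
  assumes "b > 1" "box_seq b s" and "A < (b ^ CARD('d)) ^ Suc m"
  obtains a where "a \<in> digit_vectors b"
    and "s A = (1 / real b ^ Suc m) *\<^sub>R a + s (A mod (b ^ CARD('d)) ^ m)"
proof -
  let ?B = "b ^ CARD('d)"
  obtain a where a: "\<And>m. bij_betw (a m) {1..?B - 1} (digit_vectors b - {0})"
    and s: "\<And>m k i. k \<in> {1..?B - 1} \<Longrightarrow> i < ?B ^ m \<Longrightarrow>
      s (k * ?B ^ m + i) = (1 / real b ^ Suc m) *\<^sub>R a m k + s i"
    using box_seqE[OF assms(2)] by blast
  define k where "k = A div ?B ^ m"
  have B: "?B > 0" using assms(1) by simp
  have k: "k < ?B" using assms(3) unfolding k_def power_Suc by (rule less_mult_imp_div_less)
  show thesis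
  proof (cases "k = 0")
    case True
    then have "A mod ?B ^ m = A" by (metis k_def div_mult_mod_eq mult_zero_left add_0)
    moreover have "0 \<in> (digit_vectors b :: (real^'d) set)"
      using assms(1) by (auto simp: digit_vectors_def intro!: exI[of _ 0])
    ultimately show thesis using that[of 0] by (simp del: power_Suc)
  next
    case False
    then have "k \<in> {1..?B - 1}" using k by auto
    moreover from this have "a m k \<in> digit_vectors b" using a[of m] by (auto simp: bij_betw_def)
    moreover have "A mod ?B ^ m < ?B ^ m" using B by simp
    ultimately have "s (k * ?B ^ m + A mod ?B ^ m)
        = (1 / real b ^ Suc m) *\<^sub>R a m k + s (A mod ?B ^ m)"
      by (intro s)
    moreover have "k * ?B ^ m + A mod ?B ^ m = A" unfolding k_def by (rule div_mult_mod_eq)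
    ultimately show thesis
      using that \<open>a m k \<in> digit_vectors b\<close> by metis
  qed
qed

lemma add_le_of_dvd_less:
  fixes p r q :: nat
  assumes "p dvd r" "p dvd q" "r < q"
  shows "r + p \<le> q"
proof -
  have "p dvd q - r" using assms by (simp add: dvd_diff_nat)
  then have "p \<le> q - r" using assms(3) by (intro dvd_imp_le) auto
  then show ?thesis using assms(3) by simp
qed

text \<open>
  Writing \<open>A\<close> in base \<open>B\<close>, the recursion adds one vector per nonzero digit, the vector depending only
  on the digit and its position. The digits of \<open>A\<close> and \<open>i\<close> occupy different positions, hence
  their contributions add. The induction strips the leading digit of \<open>A\<close>.
\<close>
lemma box_seq_shift:
  fixes s :: "nat \<Rightarrow> real^'d"
  assumes "b > 1" "box_seq b s" and "(b ^ CARD('d)) ^ j dvd A" "i < (b ^ CARD('d)) ^ j"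
  shows "s (A + i) = s A + s i"
  using assms(3)
proof (induction A rule: less_induct)
  case (less A)
  let ?B = "b ^ CARD('d)"
  show ?case
  proof (cases "A = 0")
    case True
    then show ?thesis using box_seq_0[OF assms(2)] by simp
  next
    case False
    have "1 < ?B" using assms(1) by (rule one_less_power) simp
    then have B: "?B \<ge> 2" by linarith
    obtain m where m: "?B ^ m \<le> A" "A < ?B ^ (m + 1)"
      using ex_power_ivl1[OF B, of A] False by auto
    obtain a where "\<And>m. bij_betw (a m) {1..?B - 1} (digit_vectors b - {0})"
      and s: "\<And>m k i. k \<in> {1..?B - 1} \<Longrightarrow> i < ?B ^ m \<Longrightarrow>
      s (k * ?B ^ m + i) = (1 / real b ^ Suc m) *\<^sub>R a m k + s i"
      using box_seqE[OF assms(2)] by blast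
    define k r where "k = A div ?B ^ m" and "r = A mod ?B ^ m"
    have A: "A = k * ?B ^ m + r" unfolding k_def r_def by (rule div_mult_mod_eq[symmetric])
    have "?B ^ j \<le> A" using less.prems False by (intro dvd_imp_le) simp_all
    then have "?B ^ j < ?B ^ (m + 1)" using m(2) by (rule le_less_trans)
    then have "j < m + 1" by (rule power_less_imp_less_exp[OF \<open>1 < ?B\<close>])
    then have jm: "?B ^ j dvd ?B ^ m" by (intro le_imp_power_dvd) simp
    have r: "?B ^ j dvd r" unfolding r_def using less.prems jm by (rule dvd_mod)
    have rm: "r < ?B ^ m" unfolding r_def using assms(1) by (intro mod_less_divisor) simp
    have "r + ?B ^ j \<le> ?B ^ m"
      using add_le_of_dvd_less[OF r jm rm] .
    then have ri: "r + i < ?B ^ m" using assms(4) by simp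
    have k: "k \<in> {1..?B - 1}"
    proof -
      have "k < ?B" using m(2) unfolding k_def Suc_eq_plus1[symmetric] power_Suc
        by (rule less_mult_imp_div_less)
      moreover have "k > 0" unfolding k_def div_greater_zero_iff using m(1) assms(1) by simp
      ultimately show ?thesis by auto
    qed
    have "r < A" using rm m(1) by simp
    from less.IH[OF this r] have "s (r + i) = s r + s i" .
    then show ?thesis
      using s[OF k ri] s[OF k rm] by (simp only: A add.assoc)
  qed
qed

text \<open>
  Digit vectors have entries at most \<open>b - 1\<close>, so the positions \<open>j, ..., m - 1\<close> contribute at
  most \<open>(b - 1) (b^(-j-1) + ... + b^(-m)) = b^(-j) - b^(-m)\<close> to a coordinate. The gap \<open>b^(-m)\<close> is what
  lets a whole cell of side \<open>b^(-m)\<close> at \<open>s A\<close> fit below \<open>b^(-j)\<close>.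
\<close>
lemma box_seq_bounds:
  fixes s :: "nat \<Rightarrow> real^'d"
  assumes "b > 1" "box_seq b s" and "(b ^ CARD('d)) ^ j dvd A" "A < (b ^ CARD('d)) ^ m" "j \<le> m"
  shows "0 \<le> s A $ t" and "s A $ t + 1 / real b ^ m \<le> 1 / real b ^ j"
proof -
  let ?B = "b ^ CARD('d)"
  have "0 \<le> s A $ t \<and> s A $ t + 1 / real b ^ m \<le> 1 / real b ^ j"
    using assms(5,3,4)
  proof (induction m arbitrary: A rule: dec_induct)
    case base
    then have "A = 0" using dvd_imp_le by fastforce
    then show ?case using box_seq_0[OF assms(2)] by simp
  next
    case (step m)
    obtain a where a: "a \<in> digit_vectors b"
      and s: "s A = (1 / real b ^ Suc m) *\<^sub>R a + s (A mod ?B ^ m)"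
      using box_seq_leading_digit[OF assms(1,2) step.prems(2)] by blast
    obtain z where z: "z < b" "a $ t = real z"
      using a by (auto simp: digit_vectors_def)
    have "?B ^ j dvd A mod ?B ^ m"
      using step by (simp add: dvd_mod le_imp_power_dvd)
    moreover have "A mod ?B ^ m < ?B ^ m" using assms(1) by simp
    ultimately have IH: "0 \<le> s (A mod ?B ^ m) $ t"
      "s (A mod ?B ^ m) $ t + 1 / real b ^ m \<le> 1 / real b ^ j"
      using step.IH by auto
    have "real z / real b ^ Suc m + 1 / real b ^ Suc m = (real z + 1) / real b ^ Suc m"
      by (simp add: add_divide_distrib)
    also have "\<dots> \<le> real b / real b ^ Suc m"
      using z assms(1) by (intro divide_right_mono) auto
    also have "\<dots> = 1 / real b ^ m" using assms(1) by simp
    finally show ?case using IH z by (simp add: s)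
  qed
  then show "0 \<le> s A $ t" and "s A $ t + 1 / real b ^ m \<le> 1 / real b ^ j" by auto
qed

lemma box_seq_in_fine_grid:
  fixes s :: "nat \<Rightarrow> real^'d"
  assumes "b > 1" "box_seq b s" and "A < (b ^ CARD('d)) ^ m"
  shows "s A \<in> fine_grid (b ^ m)"
  using assms(3)
proof (induction m arbitrary: A)
  case 0
  then show ?case using box_seq_0[OF assms(2)] by (auto simp: fine_grid_def intro!: exI[of _ 0])
next
  case (Suc m)
  let ?B = "b ^ CARD('d)"
  obtain a where a: "a \<in> digit_vectors b"
    and s: "s A = (1 / real b ^ Suc m) *\<^sub>R a + s (A mod ?B ^ m)"
    using box_seq_leading_digit[OF assms(1,2) Suc.prems] by blast
  have IH: "s (A mod ?B ^ m) \<in> fine_grid (b ^ m)"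
    using assms(1) by (intro Suc.IH) simp
  show ?case unfolding fine_grid_def
  proof (intro CollectI allI)
    fix t
    obtain z where z: "a $ t = real z" using a by (auto simp: digit_vectors_def)
    obtain y :: int where y: "s (A mod ?B ^ m) $ t = of_int y / real (b ^ m)"
      using IH by (auto simp: fine_grid_def)
    show "\<exists>w::int. s A $ t = of_int w / real (b ^ Suc m)"
      using assms(1) by (intro exI[of _ "int z + int b * y"]) (simp add: s z y field_simps)
  qed
qed

text \<open>
  Surjectivity is the expansion of lattice coordinates in base \<open>b\<close>, where the last
  digit of the numerators is the vector added in the last step; injectivity follows by counting.
\<close>
lemma box_seq_bij_betw_cube_lattice:
  fixes s :: "nat \<Rightarrow> real^'d"
  assumes "b > 1" "box_seq b s"
  shows "bij_betw s {..<(b ^ CARD('d)) ^ m} (cube_lattice (b ^ m))"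
proof -
  let ?B = "b ^ CARD('d)"
  have "cube_lattice (b ^ m) \<subseteq> s ` {..<?B ^ m}"
  proof (induction m)
    case 0
    show ?case using box_seq_0[OF assms(2)] cube_lattice_1 by force
  next
    case (Suc m)
    obtain a where a: "\<And>m. bij_betw (a m) {1..?B - 1} (digit_vectors b - {0})"
      and s: "\<And>m k i. k \<in> {1..?B - 1} \<Longrightarrow> i < ?B ^ m \<Longrightarrow>
        s (k * ?B ^ m + i) = (1 / real b ^ Suc m) *\<^sub>R a m k + s i"
      using box_seqE[OF assms(2)] by blast
    show ?case
    proof
      fix x :: "real^'d" assume x: "x \<in> cube_lattice (b ^ Suc m)"
      then obtain z :: "'d \<Rightarrow> int" where z: "\<And>i. x $ i = of_int (z i) / real (b ^ Suc m)"
        using fine_gridE unfolding cube_lattice_def by blast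
      have x01: "0 \<le> x $ i" "x $ i < 1" for i
        using x by (auto simp: cube_lattice_def half_open_cube_def)
      have bpos: "real (b ^ Suc m) > 0" using assms(1) by simp
      have zn: "0 \<le> z i" for i
        using x01(1)[of i] z[of i] bpos by (simp add: zero_le_divide_iff)
      have zu: "z i < int b * int b ^ m" for i
      proof -
        have "of_int (z i) < real (b ^ Suc m)"
          using x01(2)[of i] z[of i] bpos by (simp add: divide_less_eq)
        then have "real_of_int (z i) < real_of_int (int (b ^ Suc m))" by simp
        then have "z i < int (b ^ Suc m)" by (simp only: of_int_less_iff)
        then show ?thesis by simp
      qed
      \<comment> \<open>Here \<open>y\<close> is \<open>x\<close> rounded down to the coarser lattice, and \<open>c\<close> consists of the dropped digits.\<close>
      define c y :: "real^'d" where "c = (\<chi> i. of_int (z i mod int b))"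
        and "y = (\<chi> i. of_int (z i div int b) / real (b ^ m))"
      have xcy: "x = (1 / real b ^ Suc m) *\<^sub>R c + y"
      proof -
        have "real_of_int (z i) = of_int (z i mod int b) + real b * of_int (z i div int b)" for i
          by (metis mod_mult_div_eq of_int_add of_int_mult of_int_of_nat_eq)
        then show ?thesis
          using assms(1) by (simp add: vec_eq_iff z c_def y_def field_simps)
      qed
      have "y \<in> cube_lattice (b ^ m)"
      proof -
        have "0 \<le> z i div int b" for i
          using zn[of i] assms(1) by (simp add: pos_imp_zdiv_nonneg_iff)
        moreover have "real_of_int (z i div int b) < real b ^ m" for i
        proof -
          have "int b * (z i div int b) + z i mod int b < int b * int b ^ m"
            using zu[of i] by simp
          moreover have "0 \<le> z i mod int b" using assms(1) by simp
          ultimately have "int b * (z i div int b) < int b * int b ^ m" by linarith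
          then have "z i div int b < int b ^ m" using assms(1) by simp
          then have "real_of_int (z i div int b) < real_of_int (int b ^ m)"
            by (simp only: of_int_less_iff)
          then show ?thesis by simp
        qed
        ultimately show ?thesis
          using assms(1) by (auto simp: y_def cube_lattice_def fine_grid_def half_open_cube_def)
      qed
      then obtain i where i: "i < ?B ^ m" "y = s i" using Suc.IH by auto
      have "c \<in> digit_vectors b"
      proof -
        have "c $ i = real (nat (z i mod int b)) \<and> nat (z i mod int b) < b" for i
          using assms(1) by (simp add: c_def nat_less_iff)
        then show ?thesis unfolding digit_vectors_def by blast
      qed
      then consider "c = 0" | k where "k \<in> {1..?B - 1}" "c = a m k"
        using bij_betw_imp_surj_on[OF a[of m]] by blast
      then show "x \<in> s ` {..<?B ^ Suc m}"
      proof cases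
        case 1
        have "i < ?B ^ Suc m" using i(1) assms(1)
          by (meson less_le_trans power_increasing less_imp_le one_le_power le_SucI order_refl)
        then show ?thesis using 1 xcy i by auto
      next
        case 2
        then have "x = s (k * ?B ^ m + i)" using s i xcy by simp
        moreover have "k * ?B ^ m + i < ?B ^ Suc m"
        proof -
          have "k * ?B ^ m + i < Suc k * ?B ^ m" using i by simp
          also have "\<dots> \<le> ?B * ?B ^ m"
            using 2 assms(1) by (intro mult_right_mono) auto
          finally show ?thesis by simp
        qed
        ultimately show ?thesis by auto
      qed
    qed
  qed
  moreover have "s ` {..<?B ^ m} \<subseteq> cube_lattice (b ^ m)"
  proof (intro image_subsetI)
    fix A assume "A \<in> {..<?B ^ m}"
    then have A: "A < ?B ^ m" by simp
    have "(b ^ CARD('d)) ^ 0 dvd A" by simp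
    note bounds = box_seq_bounds[OF assms this A le0]
    have "1 / real b ^ m > 0" using assms(1) by simp
    then have "0 \<le> s A $ t \<and> s A $ t < 1" for t
      using bounds[of t] unfolding power_0 div_by_1 by linarith
    then show "s A \<in> cube_lattice (b ^ m)"
      using box_seq_in_fine_grid[OF assms A] by (auto simp: cube_lattice_def half_open_cube_def)
  qed
  ultimately have im: "s ` {..<?B ^ m} = cube_lattice (b ^ m)" by blast
  have "card (cube_lattice (b ^ m) :: (real^'d) set) = ?B ^ m"
    using assms(1) by (simp add: card_cube_lattice power_mult[symmetric] mult.commute)
  then have "inj_on s {..<?B ^ m}"
    using im by (intro eq_card_imp_inj_on) auto
  then show ?thesis using im by (simp add: bij_betw_def)
qed


section \<open>Blocks of consecutive terms\<close>

text \<open>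
  By additivity the block is the lattice of resolution \<open>b^j\<close> translated by \<open>s A\<close>.
\<close>
lemma box_seq_block:
  fixes s :: "nat \<Rightarrow> real^'d"
  assumes "b > 1" "box_seq b s" and L: "L j = {cube_lattice (b ^ j)}" and "j \<le> Suc n"
    and "(b ^ CARD('d)) ^ j dvd A" "A + (b ^ CARD('d)) ^ j \<le> (b ^ CARD('d)) ^ Suc n"
  shows "\<exists>(\<omega>, v)\<in>Omega b L j (enat n).
    image_mset s (mset_set {A..<A + (b ^ CARD('d)) ^ j}) = mset_set ((+) v ` \<omega>)"
proof -
  let ?B = "b ^ CARD('d)"
  let ?I = "{A..<A + ?B ^ j}"
  have A: "A < ?B ^ Suc n"
    using assms(6) by (rule less_le_trans[rotated]) (use assms(1) in simp)
  have pos: "0 < 1 / real b ^ m" for m using assms(1) by simp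
  have I: "?I = (+) A ` {..<?B ^ j}"
    by (simp add: lessThan_atLeast0 add.commute)
  have lat: "s ` {..<?B ^ j} = cube_lattice (b ^ j)" "inj_on s {..<?B ^ j}"
    using box_seq_bij_betw_cube_lattice[OF assms(1,2), of j] by (auto simp: bij_betw_def)
  have im: "s ` ?I = (+) (s A) ` cube_lattice (b ^ j)"
    unfolding I lat(1)[symmetric] image_image
    using box_seq_shift[OF assms(1,2,5)] by (intro image_cong) auto
  have "inj_on s {..<?B ^ Suc n}"
    using box_seq_bij_betw_cube_lattice[OF assms(1,2), of "Suc n"] by (simp only: bij_betw_def)
  then have "inj_on s ?I"
    by (rule inj_on_subset) (use assms(6) in auto)
  then have mset: "image_mset s (mset_set ?I) = mset_set ((+) (s A) ` cube_lattice (b ^ j))"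
    by (simp only: image_mset_mset_set im)
  have "s ` ?I \<subseteq> cube_lattice (b ^ Suc n)"
    using box_seq_bij_betw_cube_lattice[OF assms(1,2), of "Suc n"] assms(6)
    by (auto simp: bij_betw_def simp del: power_Suc)
  then have sub: "(+) (s A) ` cube_lattice (b ^ j) \<subseteq> half_open_cube 1"
    unfolding im by (auto simp: cube_lattice_def simp del: power_Suc)
  have "0 \<le> s A $ t \<and> s A $ t < 1 / real b ^ j" for t
    using box_seq_bounds[OF assms(1,2,5) A assms(4), of t] pos[of "Suc n"] by linarith
  then have "s A \<in> shifts b j (enat n)"
    using box_seq_in_fine_grid[OF assms(1,2) A]
    by (simp add: shifts_def half_open_cube_def del: power_Suc)
  then have "(cube_lattice (b ^ j), s A) \<in> Omega b L j (enat n)"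
    using sub L by (simp add: Omega_def)
  then show ?thesis using mset by blast
qed

text \<open>
  Let \<open>k B^m\<close> be the leading part of \<open>A\<close> and \<open>r\<close> the rest. Condition (ii) places \<open>q (A + i)\<close> in the cell
  of side \<open>b^(-m)\<close> at \<open>s (r + i) = s r + s i\<close>. The coordinates of \<open>s r\<close> are at most
  \<open>b^(-j) - b^(-m)\<close>, so this cell is contained in the cell of side \<open>b^(-j)\<close> at \<open>s i\<close>.
\<close>
lemma guided_seq_cell:
  fixes s q :: "nat \<Rightarrow> real^'d"
  assumes "b > 1" "box_seq b s" "guided_seq b s q"
    and "(b ^ CARD('d)) ^ j dvd A" "A > 0" "i < (b ^ CARD('d)) ^ j"
  shows "q (A + i) \<in> (+) (s i) ` half_open_cube (1 / real (b ^ j))"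
proof -
  let ?B = "b ^ CARD('d)"
  have B1: "1 < ?B" using assms(1) by (rule one_less_power) simp
  then have B: "?B \<ge> 2" by linarith
  obtain m where m: "?B ^ m \<le> A" "A < ?B ^ (m + 1)"
    using ex_power_ivl1[OF B, of A] assms(5) by auto
  define k r where "k = A div ?B ^ m" and "r = A mod ?B ^ m"
  have A: "A = k * ?B ^ m + r" unfolding k_def r_def by (rule div_mult_mod_eq[symmetric])
  have "?B ^ j \<le> A" using assms(4,5) by (rule dvd_imp_le)
  then have "?B ^ j < ?B ^ (m + 1)" using m(2) by (rule le_less_trans)
  then have "j < m + 1" by (rule power_less_imp_less_exp[OF B1])
  then have jm: "j \<le> m" by simp
  then have dvd: "?B ^ j dvd ?B ^ m" by (rule le_imp_power_dvd)
  have r: "?B ^ j dvd r" unfolding r_def using assms(4) dvd by (rule dvd_mod)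
  have rm: "r < ?B ^ m" unfolding r_def using assms(1) by (intro mod_less_divisor) simp
  have "r + ?B ^ j \<le> ?B ^ m" using add_le_of_dvd_less[OF r dvd rm] .
  then have ri: "r + i < ?B ^ m" using assms(6) by simp
  have "k < ?B" using m(2) unfolding k_def Suc_eq_plus1[symmetric] power_Suc
    by (rule less_mult_imp_div_less)
  moreover have "k > 0" unfolding k_def div_greater_zero_iff using m(1) assms(1) by simp
  ultimately have k: "1 \<le> k \<and> k < ?B" by simp
  have "\<forall>m. \<forall>r < b ^ (CARD('d) * m). \<forall>k. 1 \<le> k \<and> k < ?B \<longrightarrow>
      q (r + k * b ^ (CARD('d) * m)) \<in> (+) (s r) ` half_open_cube (1 / real b ^ m)"
    using assms(3) unfolding guided_seq_def by blast
  from this[unfolded power_mult, rule_format, OF ri k]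
  have "q (r + i + k * ?B ^ m) \<in> (+) (s (r + i)) ` half_open_cube (1 / real b ^ m)" .
  moreover have "r + i + k * ?B ^ m = A + i" using A by simp
  ultimately have "q (A + i) \<in> (+) (s r + s i) ` half_open_cube (1 / real b ^ m)"
    using box_seq_shift[OF assms(1,2) r assms(6)] by simp
  then have "s r $ t + s i $ t \<le> q (A + i) $ t \<and>
      q (A + i) $ t < s r $ t + s i $ t + 1 / real b ^ m" for t
    unfolding mem_cell_iff by simp
  moreover have "0 \<le> s r $ t \<and> s r $ t + 1 / real b ^ m \<le> 1 / real b ^ j" for t
    using box_seq_bounds[OF assms(1,2) r rm jm] by blast
  ultimately have "s i $ t \<le> q (A + i) $ t \<and> q (A + i) $ t < s i $ t + 1 / real (b ^ j)" for t
    by (smt (verit) of_nat_power)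
  then show ?thesis unfolding mem_cell_iff by blast
qed

text \<open>
  For \<open>A > 0\<close> the terms lie in the cells at the distinct lattice points \<open>s i\<close>. The block that starts at
  \<open>0\<close> has no leading digit to guide it and is covered by condition (i).
\<close>
lemma guided_seq_block_perturbed_lattice:
  fixes s q :: "nat \<Rightarrow> real^'d"
  assumes "b > 1" "box_seq b s" "guided_seq b s q"
    and "(b ^ CARD('d)) ^ j dvd A"
  shows "perturbed_lattice (b ^ j) (q ` {A..<A + (b ^ CARD('d)) ^ j})"
    and "inj_on q {A..<A + (b ^ CARD('d)) ^ j}"
proof -
  let ?B = "b ^ CARD('d)"
  let ?I = "{A..<A + ?B ^ j}"
  have bj: "b ^ j > 0" using assms(1) by simp
  have q01: "q i \<in> half_open_cube 1" for i
    using assms(3) by (simp add: guided_seq_def)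
  have "perturbed_lattice (b ^ j) (q ` ?I) \<and> inj_on q ?I"
  proof (cases "A = 0")
    case True
    then have I: "?I = {..<?B ^ j}" by (simp add: lessThan_atLeast0)
    have cells: "card (q ` {..<?B ^ j} \<inter> (+) v ` half_open_cube (1 / real (b ^ j))) = 1"
      if v: "v \<in> cube_lattice (b ^ j)" for v
    \<comment> \<open>Condition (i) starts at resolution \<open>b\<close>; for \<open>j = 0\<close> the only cell is the unit cube.\<close>
    proof (cases j)
      case 0
      have "v = 0" using v 0 cube_lattice_1 by simp
      moreover have "{..<?B ^ j} = {0}" using 0 by auto
      ultimately show ?thesis using q01[of 0] 0 by simp
    next
      case (Suc m)
      have "\<forall>m. \<forall>v\<in>cube_lattice (b ^ (m + 1)).
          card (q ` {..<b ^ (CARD('d) * (m + 1))} \<inter> (+) v ` half_open_cube (1 / real b ^ (m + 1))) = 1"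
        using assms(3) unfolding guided_seq_def by blast
      from this[unfolded power_mult, rule_format, of v m] show ?thesis
        using v Suc by (simp del: power_Suc)
    qed
    have "?B ^ j = (b ^ j) ^ CARD('d)"
      by (simp add: power_mult[symmetric] mult.commute)
    then have "?B ^ j \<le> card (q ` {..<?B ^ j})"
      using card_ge_of_cells_met[OF bj _ cells] by simp
    moreover have "card (q ` {..<?B ^ j}) \<le> ?B ^ j"
      using card_image_le[of "{..<?B ^ j}" q] by simp
    ultimately have card: "card (q ` {..<?B ^ j}) = ?B ^ j" by simp
    then have "inj_on q {..<?B ^ j}" by (intro eq_card_imp_inj_on) auto
    moreover have "perturbed_lattice (b ^ j) (q ` {..<?B ^ j})"
      using cells card q01 \<open>?B ^ j = (b ^ j) ^ CARD('d)\<close>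
      by (auto simp: perturbed_lattice_def simp del: of_nat_power)
    ultimately show ?thesis using I by simp
  next
    case False
    then have A0: "A > 0" by simp
    have bij: "bij_betw (\<lambda>i. s (i - A)) ?I (cube_lattice (b ^ j))"
    proof (rule bij_betw_trans[of "\<lambda>i. i - A" _ "{..<?B ^ j}" s, unfolded o_def])
      show "bij_betw (\<lambda>i. i - A) ?I {..<?B ^ j}"
        by (rule bij_betw_byWitness[where f' = "\<lambda>i. A + i"]) auto
    qed (rule box_seq_bij_betw_cube_lattice[OF assms(1,2)])
    have "q i \<in> (+) (s (i - A)) ` half_open_cube (1 / real (b ^ j))" if "i \<in> ?I" for i
      using guided_seq_cell[OF assms A0, of "i - A"] that by (auto simp del: of_nat_power)
    then show ?thesis
      using perturbed_lattice_of_cell_points[OF bj bij, of q] q01 by blast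
  qed
  then show "perturbed_lattice (b ^ j) (q ` ?I)" and "inj_on q ?I" by auto
qed

text \<open>
  The block is itself a perturbed lattice set, so no shift is needed.
\<close>
lemma guided_seq_block:
  fixes s q :: "nat \<Rightarrow> real^'d"
  assumes "b > 1" "box_seq b s" "guided_seq b s q"
    and L: "L j = {\<omega>. perturbed_lattice (b ^ j) \<omega>}"
    and "(b ^ CARD('d)) ^ j dvd A"
  shows "\<exists>(\<omega>, v)\<in>Omega b L j (enat n).
    image_mset q (mset_set {A..<A + (b ^ CARD('d)) ^ j}) = mset_set ((+) v ` \<omega>)"
proof -
  let ?\<omega> = "q ` {A..<A + (b ^ CARD('d)) ^ j}"
  note block = guided_seq_block_perturbed_lattice[OF assms(1-3,5)]
  have "0 \<in> shifts b j (enat n)"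
    using assms(1) by (auto simp: shifts_def half_open_cube_def fine_grid_def intro!: exI[of _ 0])
  moreover have "?\<omega> \<subseteq> half_open_cube 1"
    using block(1) unfolding perturbed_lattice_def by (rule conjunct1)
  moreover have "(+) 0 ` ?\<omega> = ?\<omega>" by simp
  ultimately have "(?\<omega>, 0) \<in> Omega b L j (enat n)"
    using L block(1) unfolding Omega_def by (simp only: mem_Collect_eq case_prod_conv simp_thms)
  moreover have "image_mset q (mset_set {A..<A + (b ^ CARD('d)) ^ j}) = mset_set ((+) 0 ` ?\<omega>)"
    by (simp only: image_mset_mset_set[OF block(2)] \<open>(+) 0 ` ?\<omega> = ?\<omega>\<close>)
  ultimately show ?thesis by blast
qed

lemma block_value_le_h_sup:
  assumes "\<exists>(\<omega>, v)\<in>Omega b L m k. image_mset x M = mset_set ((+) v ` \<omega>)"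
  shows "ereal (D (emp (image_mset (P \<circ> x) M))) \<le> h_sup D P b L m k"
proof -
  obtain \<omega> v where \<omega>: "(\<omega>, v) \<in> Omega b L m k" "image_mset x M = mset_set ((+) v ` \<omega>)"
    using assms by blast
  have "image_mset (P \<circ> x) M = image_mset P (mset_set ((+) v ` \<omega>))"
    unfolding \<omega>(2)[symmetric] by (simp add: multiset.map_comp)
  then show ?thesis
    unfolding h_sup_def using \<omega>(1) by (intro SUP_upper2[of "(\<omega>, v)"]) auto
qed

lemma h_sup_le_infinity: "h_sup D P b L m (enat k) \<le> h_sup D P b L m \<infinity>"
proof -
  have "shifts b m (enat k) \<subseteq> (shifts b m \<infinity> :: (real^'d) set)"
    unfolding shifts_def by auto
  then have "Omega b L m (enat k) \<subseteq> Omega b L m \<infinity>"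
    unfolding Omega_def by auto
  then show ?thesis
    unfolding h_sup_def by (rule SUP_subset_mono) simp
qed


section \<open>Subadditivity over finite index sets\<close>

lemma f_subadditive_sum_le:
  assumes "f_subadditive f D" "finite I" "I \<noteq> {}" "\<And>i. i \<in> I \<Longrightarrow> \<nu> i \<in> emp_measures"
  shows "D (\<Sum>i\<in>I. \<nu> i) \<le> f (card I) * (\<Sum>i\<in>I. D (\<nu> i))"
proof -
  obtain g where g: "bij_betw g {1..card I} I"
    using ex_bij_betw_nat_finite_1[OF assms(2)] by blast
  have "card I \<ge> 1" using assms(2,3) by (simp add: Suc_leI card_gt_0_iff)
  moreover have "\<forall>j\<in>{1..card I}. \<nu> (g j) \<in> emp_measures"
    using g assms(4) by (auto simp: bij_betw_def)
  ultimately have "D (\<Sum>j=1..card I. \<nu> (g j)) \<le> f (card I) * (\<Sum>j=1..card I. D (\<nu> (g j)))"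
    using assms(1)[unfolded f_subadditive_def, rule_format, of "card I" "\<lambda>j. \<nu> (g j)"] by blast
  then show ?thesis
    using sum.reindex_bij_betw[OF g, of \<nu>] sum.reindex_bij_betw[OF g, of "\<lambda>i. D (\<nu> i)"] by simp
qed

lemma f_subadditive_diff_sum_le:
  assumes "f_subadditive_diff f D" "finite I" "I \<noteq> {}" "\<And>i. i \<in> I \<Longrightarrow> \<mu> i \<in> emp_measures"
    and "\<nu> \<in> emp_measures"
  shows "D (\<nu> - (\<Sum>i\<in>I. \<mu> i)) \<le> f (1 + card I) * (D \<nu> + (\<Sum>i\<in>I. D (\<mu> i)))"
proof -
  obtain g where g: "bij_betw g {1..card I} I"
    using ex_bij_betw_nat_finite_1[OF assms(2)] by blast
  have "card I \<ge> 1" using assms(2,3) by (simp add: Suc_leI card_gt_0_iff)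
  moreover have "\<forall>j\<in>{1..card I}. \<mu> (g j) \<in> emp_measures"
    using g assms(4) by (auto simp: bij_betw_def)
  moreover have "\<forall>j\<in>{1..1::nat}. \<nu> \<in> emp_measures" using assms(5) by simp
  ultimately have "D ((\<Sum>j=1..1::nat. \<nu>) - (\<Sum>j=1..card I. \<mu> (g j)))
      \<le> f (1 + card I) * (\<Sum>j=1..1::nat. D \<nu>) + f (1 + card I) * (\<Sum>j=1..card I. D (\<mu> (g j)))"
    using assms(1)[unfolded f_subadditive_diff_def, rule_format, of 1 "card I" "\<lambda>_. \<nu>" "\<lambda>j. \<mu> (g j)"]
    by blast
  then show ?thesis
    using sum.reindex_bij_betw[OF g, of \<mu>] sum.reindex_bij_betw[OF g, of "\<lambda>i. D (\<mu> i)"]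
    by (simp add: distrib_left)
qed

lemma emp_image_mset_set: "emp (image_mset Z (mset_set A)) = (\<Sum>i\<in>A. dirac (Z i))"
  by (simp add: emp_def sum_unfold_sum_mset multiset.map_comp o_def)

lemma sum_dirac_in_emp_measures:
  assumes "finite A" "A \<noteq> {}"
  shows "(\<Sum>i\<in>A. dirac (Z i)) \<in> emp_measures"
  unfolding emp_image_mset_set[symmetric] emp_measures_def
  using assms by (auto simp: mset_set_empty_iff)


section \<open>Cutting an interval according to digits\<close>

lemma sum_consecutive_blocks:
  fixes g :: "nat \<Rightarrow> 'a::comm_monoid_add"
  shows "(\<Sum>k<e. sum g {a + k * p..<a + k * p + p}) = sum g {a..<a + e * p}"
proof (induction e)
  case (Suc e)
  have "sum g {a..<a + e * p} + sum g {a + e * p..<a + e * p + p} = sum g {a..<a + e * p + p}"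
    by (rule sum.atLeastLessThan_concat) auto
  then show ?case using Suc.IH by (simp add: algebra_simps)
qed simp

text \<open>
  The index pairs of a decomposition with \<open>e j\<close> blocks on each level \<open>j\<close>; the places of
  the blocks are given by \<open>block\<close>, where \<open>a j\<close> is the point at which level \<open>j\<close> starts.
\<close>
definition blocks :: "nat \<Rightarrow> (nat \<Rightarrow> nat) \<Rightarrow> (nat \<times> nat) set" where
  "blocks n e = (SIGMA j:{0..n}. {..<e j})"

lemma finite_blocks: "finite (blocks n e)"
  by (simp add: blocks_def)

lemma card_blocks: "card (blocks n e) = (\<Sum>j=0..n. e j)"
  by (simp add: blocks_def)

lemma sum_blocks: "(\<Sum>(j, k)\<in>blocks n e. g j k) = (\<Sum>j=0..n. \<Sum>k<e j. g j k)"
  by (simp add: blocks_def sum.Sigma)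

definition block :: "nat \<Rightarrow> (nat \<Rightarrow> nat) \<Rightarrow> nat \<Rightarrow> nat \<Rightarrow> nat set" where
  "block B a j k = {a j + k * B ^ j..<a j + k * B ^ j + B ^ j}"

lemma sum_ereal_const: "(\<Sum>k<e. c) = ereal (real e) * c" for c :: ereal
proof (induction e)
  case (Suc e)
  have "ereal (real (Suc e)) * c = ereal (real e) * c + ereal 1 * c"
    by (subst ereal_left_distrib[symmetric]) (auto simp: add.commute)
  then show ?case using Suc by simp
qed simp

text \<open>
  Transports a bound for \<open>\<phi>\<close> on every block of each level to a bound for a whole decomposition. It
  suffices that each level starts at a multiple of its block length and stays below \<open>M\<close>.
\<close>
lemma sum_block_values_le:
  assumes "\<And>j A. j \<le> n \<Longrightarrow> B ^ j dvd A \<Longrightarrow> A + B ^ j \<le> M \<Longrightarrow>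
      ereal (\<phi> {A..<A + B ^ j}) \<le> h j"
    and "\<And>j. j \<le> n \<Longrightarrow> B ^ j dvd a j" "\<And>j. j \<le> n \<Longrightarrow> a j + e j * B ^ j \<le> M"
  shows "ereal (\<Sum>(j, k)\<in>blocks n e. \<phi> (block B a j k)) \<le> (\<Sum>j=0..n. ereal (real (e j)) * h j)"
proof -
  have "ereal (\<phi> (block B a j k)) \<le> h j" if "j \<le> n" "k < e j" for j k
    unfolding block_def
  proof (rule assms(1)[OF that(1)])
    show "B ^ j dvd a j + k * B ^ j" using assms(2)[OF that(1)] by simp
    have "Suc k * B ^ j \<le> e j * B ^ j" using that(2) by (intro mult_right_mono) auto
    then show "a j + k * B ^ j + B ^ j \<le> M" using assms(3)[OF that(1)] by simp
  qed
  then have "(\<Sum>j=0..n. \<Sum>k<e j. ereal (\<phi> (block B a j k))) \<le> (\<Sum>j=0..n. \<Sum>k<e j. h j)"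
    by (intro sum_mono) auto
  then show ?thesis by (simp add: sum_blocks sum_ereal_const)
qed

text \<open>
  Levels arranged with the longest blocks on the left: level \<open>j\<close> occupies \<open>{T (Suc j)..<T j}\<close>.
\<close>
lemma sum_blocks_descending:
  fixes g :: "nat \<Rightarrow> 'a::comm_monoid_add"
  assumes "\<And>j. j \<le> n \<Longrightarrow> T j = T (Suc j) + e j * B ^ j"
  shows "(\<Sum>(j, k)\<in>blocks n e. sum g (block B (\<lambda>j. T (Suc j)) j k)) = sum g {T (Suc n)..<T 0}"
proof -
  have "(\<Sum>j=0..m. sum g {T (Suc j)..<T j}) = sum g {T (Suc m)..<T 0} \<and> T (Suc m) \<le> T 0"
    if "m \<le> n" for m
    using that
  proof (induction m)
    case 0
    then show ?case using assms[of 0] by simp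
  next
    case (Suc m)
    have "T (Suc (Suc m)) \<le> T (Suc m)" using assms[OF Suc.prems] by simp
    then show ?case using Suc sum.atLeastLessThan_concat[of "T (Suc (Suc m))" "T (Suc m)" "T 0" g]
      by (simp add: add.commute)
  qed
  then have "(\<Sum>j=0..n. sum g {T (Suc j)..<T j}) = sum g {T (Suc n)..<T 0}" by blast
  moreover have "(\<Sum>j=0..n. sum g {T (Suc j)..<T j})
      = (\<Sum>j=0..n. \<Sum>k<e j. sum g (block B (\<lambda>j. T (Suc j)) j k))"
    unfolding block_def sum_consecutive_blocks using assms by (intro sum.cong) auto
  ultimately show ?thesis by (simp add: sum_blocks)
qed

text \<open>
  Levels arranged with the shortest blocks on the left: level \<open>j\<close> occupies \<open>{c j..<c (Suc j)}\<close>.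
\<close>
lemma sum_blocks_ascending:
  fixes g :: "nat \<Rightarrow> 'a::comm_monoid_add"
  assumes "\<And>j. j \<le> n \<Longrightarrow> c (Suc j) = c j + e j * B ^ j"
  shows "(\<Sum>(j, k)\<in>blocks n e. sum g (block B c j k)) = sum g {c 0..<c (Suc n)}"
proof -
  have "(\<Sum>j=0..m. sum g {c j..<c (Suc j)}) = sum g {c 0..<c (Suc m)} \<and> c 0 \<le> c (Suc m)"
    if "m \<le> n" for m
    using that
  proof (induction m)
    case 0
    then show ?case using assms[of 0] by simp
  next
    case (Suc m)
    have "c (Suc m) \<le> c (Suc (Suc m))" using assms[OF Suc.prems] by simp
    then show ?case using Suc by (simp add: sum.atLeastLessThan_concat)
  qed
  then have "(\<Sum>j=0..n. sum g {c j..<c (Suc j)}) = sum g {c 0..<c (Suc n)}" by blast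
  moreover have "(\<Sum>j=0..n. sum g {c j..<c (Suc j)})
      = (\<Sum>j=0..n. \<Sum>k<e j. sum g (block B c j k))"
    unfolding block_def sum_consecutive_blocks using assms by (intro sum.cong) auto
  ultimately show ?thesis by (simp add: sum_blocks)
qed

text \<open>
  The number that keeps the digits from position \<open>j\<close> on. These are the cut points of the
  interval below \<open>digit_tail B n \<epsilon> 0\<close>.
\<close>
definition digit_tail :: "nat \<Rightarrow> nat \<Rightarrow> (nat \<Rightarrow> nat) \<Rightarrow> nat \<Rightarrow> nat" where
  "digit_tail B n \<epsilon> j = (\<Sum>i=j..n. \<epsilon> i * B ^ i)"

lemma digit_tail_rec: "j \<le> n \<Longrightarrow> digit_tail B n \<epsilon> j = digit_tail B n \<epsilon> (Suc j) + \<epsilon> j * B ^ j"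
  by (simp add: digit_tail_def sum.atLeast_Suc_atMost)

lemma digit_tail_Suc_self: "digit_tail B n \<epsilon> (Suc n) = 0"
  by (simp add: digit_tail_def)

lemma power_dvd_digit_tail: "B ^ j dvd digit_tail B n \<epsilon> i" if "j \<le> i"
  unfolding digit_tail_def
  using that by (intro dvd_sum dvd_mult le_imp_power_dvd) simp

text \<open>
  The number \<open>digit_tail B n \<epsilon> j + B^j\<close> is the next multiple of \<open>B^j\<close> after the \<open>j\<close>-th tail. Adding
  the complementary digit reaches the corresponding number of the next level, so these numbers are the
  cut points above the initial segment.
\<close>
lemma digit_tail_complement:
  assumes "j \<le> n" "\<epsilon> j \<le> B - 1" "B > 0"
  shows "digit_tail B n \<epsilon> (Suc j) + B ^ Suc j = digit_tail B n \<epsilon> j + B ^ j + (B - 1 - \<epsilon> j) * B ^ j"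
proof -
  have "B = \<epsilon> j + 1 + (B - 1 - \<epsilon> j)" using assms by simp
  then have "B * B ^ j = (\<epsilon> j + 1 + (B - 1 - \<epsilon> j)) * B ^ j" by (rule arg_cong)
  also have "\<dots> = \<epsilon> j * B ^ j + B ^ j + (B - 1 - \<epsilon> j) * B ^ j"
    by (simp only: add_mult_distrib mult_1)
  finally show ?thesis using digit_tail_rec[OF assms(1), of B \<epsilon>] by simp
qed

text \<open>
  By the previous lemma the left side is nondecreasing in \<open>j\<close> and ends at \<open>B^(n+1)\<close>. All blocks of
  both decompositions therefore lie below \<open>B^(n+1)\<close>.
\<close>
lemma digit_tail_add_power_le:
  assumes "\<And>j. j \<le> n \<Longrightarrow> \<epsilon> j \<le> B - 1" "B > 0" "j \<le> Suc n"
  shows "digit_tail B n \<epsilon> j + B ^ j \<le> B ^ Suc n"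
  using assms(3)
proof (induction j rule: inc_induct)
  case base
  show ?case by (simp add: digit_tail_Suc_self)
next
  case (step j)
  then have "j \<le> n" by simp
  then show ?case using digit_tail_complement[of j n \<epsilon> B] assms(1)[of j] assms(2) step.IH by linarith
qed

lemma digit_tail_complement_sum:
  assumes "\<And>j. j \<le> n \<Longrightarrow> \<epsilon> j \<le> B - 1" "B > 0"
  shows "digit_tail B n \<epsilon> 0 + (1 + (\<Sum>j=0..n. (B - 1 - \<epsilon> j) * B ^ j)) = B ^ Suc n"
proof -
  have "digit_tail B n \<epsilon> 0 + (1 + (\<Sum>j=0..m. (B - 1 - \<epsilon> j) * B ^ j))
      = digit_tail B n \<epsilon> (Suc m) + B ^ Suc m" if "m \<le> n" for m
    using that
  proof (induction m)
    case 0
    have "digit_tail B n \<epsilon> (Suc 0) + B ^ Suc 0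
        = digit_tail B n \<epsilon> 0 + B ^ 0 + (B - 1 - \<epsilon> 0) * B ^ 0"
      using assms by (intro digit_tail_complement) auto
    then show ?case
      unfolding atLeastAtMost_singleton power_0 mult_1_right by simp
  next
    case (Suc m)
    then show ?case
      using digit_tail_complement[of "Suc m" n \<epsilon> B] assms(1)[of "Suc m"] assms(2)
      by (simp del: power_Suc)
  qed
  from this[of n] show ?thesis by (simp add: digit_tail_Suc_self)
qed


section \<open>The two estimates\<close>

lemma digit_block_estimate:
  assumes "f_subadditive f D" and f: "\<forall>k\<ge>1. 0 \<le> f k" and "B > 0"
    and \<epsilon>: "\<And>j. j \<le> n \<Longrightarrow> \<epsilon> j \<le> B - 1" "\<epsilon> n \<noteq> 0"
    and h: "\<And>j A. j \<le> Suc n \<Longrightarrow> B ^ j dvd A \<Longrightarrow> A + B ^ j \<le> B ^ Suc n \<Longrightarrow>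
      ereal (D (\<Sum>i\<in>{A..<A + B ^ j}. dirac (Z i))) \<le> h j"
  shows "ereal (D (\<Sum>i<digit_tail B n \<epsilon> 0. dirac (Z i)))
    \<le> ereal (f (\<Sum>j=0..n. \<epsilon> j)) * (\<Sum>j=0..n. ereal (real (\<epsilon> j)) * h j)"
proof -
  let ?T = "digit_tail B n \<epsilon>"
  let ?\<delta> = "\<lambda>i. dirac (Z i)"
  let ?I = "blocks n \<epsilon>"
  let ?\<nu> = "\<lambda>(j, k). sum ?\<delta> (block B (\<lambda>j. ?T (Suc j)) j k)"
  have "(n, 0) \<in> ?I" using \<epsilon>(2) by (simp add: blocks_def)
  then have ne: "?I \<noteq> {}" by blast
  then have card: "card ?I \<ge> 1" by (simp add: Suc_leI card_gt_0_iff finite_blocks)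
  have "sum ?\<nu> ?I = sum ?\<delta> {..<?T 0}"
    using sum_blocks_descending[of n ?T \<epsilon> B ?\<delta>]
    by (simp add: digit_tail_rec digit_tail_Suc_self lessThan_atLeast0)
  moreover have "?\<nu> p \<in> emp_measures" if "p \<in> ?I" for p
    using assms(3) by (cases p) (auto simp: block_def intro!: sum_dirac_in_emp_measures)
  then have "D (sum ?\<nu> ?I) \<le> f (card ?I) * (\<Sum>p\<in>?I. D (?\<nu> p))"
    by (rule f_subadditive_sum_le[OF assms(1) finite_blocks ne])
  ultimately have "ereal (D (sum ?\<delta> {..<?T 0})) \<le> ereal (f (card ?I)) * ereal (\<Sum>p\<in>?I. D (?\<nu> p))"
    by simp
  also have "\<dots> \<le> ereal (f (card ?I)) * (\<Sum>j=0..n. ereal (real (\<epsilon> j)) * h j)"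
  proof (rule ereal_mult_left_mono)
    have "ereal (\<Sum>(j, k)\<in>?I. D (sum ?\<delta> (block B (\<lambda>j. ?T (Suc j)) j k)))
        \<le> (\<Sum>j=0..n. ereal (real (\<epsilon> j)) * h j)"
    proof (rule sum_block_values_le[where M = "B ^ Suc n" and \<phi> = "\<lambda>A. D (sum ?\<delta> A)"])
      show "B ^ j dvd ?T (Suc j)" for j by (rule power_dvd_digit_tail) simp
      show "?T (Suc j) + \<epsilon> j * B ^ j \<le> B ^ Suc n" if "j \<le> n" for j
        using digit_tail_add_power_le[of n \<epsilon> B j, OF \<epsilon>(1) assms(3)] digit_tail_rec[OF that, of B \<epsilon>] that
        by simp
    qed (use h in auto)
    then show "ereal (\<Sum>p\<in>?I. D (?\<nu> p)) \<le> (\<Sum>j=0..n. ereal (real (\<epsilon> j)) * h j)"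
      by (simp add: case_prod_unfold)
    show "0 \<le> ereal (f (card ?I))" using f card by simp
  qed
  finally show ?thesis by (simp add: card_blocks)
qed

lemma complementary_digit_block_estimate:
  assumes "f_subadditive_diff f D" and f: "\<forall>k\<ge>1. 0 \<le> f k" and "B > 0"
    and \<epsilon>: "\<And>j. j \<le> n \<Longrightarrow> \<epsilon> j \<le> B - 1"
    and h: "\<And>j A. j \<le> Suc n \<Longrightarrow> B ^ j dvd A \<Longrightarrow> A + B ^ j \<le> B ^ Suc n \<Longrightarrow>
      ereal (D (\<Sum>i\<in>{A..<A + B ^ j}. dirac (Z i))) \<le> h j"
  shows "ereal (D (\<Sum>i<digit_tail B n \<epsilon> 0. dirac (Z i)))
    \<le> ereal (f (2 + (\<Sum>j=0..n. B - 1 - \<epsilon> j)))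
      * (h (Suc n) + h 0 + (\<Sum>j=0..n. ereal (real (B - 1 - \<epsilon> j)) * h j))"
proof -
  let ?T = "digit_tail B n \<epsilon>"
  let ?\<delta> = "\<lambda>i. dirac (Z i)"
  \<comment> \<open>The block of length 1 after \<open>N\<close> is counted as an additional block of level 0.\<close>
  define e where "e j = (B - 1 - \<epsilon> j) + (if j = 0 then 1 else 0)" for j
  \<comment> \<open>Level 0 starts at \<open>N\<close>; with the additional block it ends where level 1 starts.\<close>
  define c where "c j = (if j = 0 then ?T 0 else ?T j + B ^ j)" for j
  let ?I = "blocks n e"
  let ?\<mu> = "\<lambda>(j, k). sum ?\<delta> (block B c j k)"
  have c_step: "c (Suc j) = c j + e j * B ^ j" if "j \<le> n" for j
    using digit_tail_complement[of j n \<epsilon> B] that \<epsilon>[OF that] assms(3)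
    by (auto simp: c_def e_def simp del: power_Suc)
  have c_end: "c (Suc n) = B ^ Suc n"
    by (simp add: c_def digit_tail_Suc_self)
  have T_le: "?T 0 \<le> B ^ Suc n"
    using digit_tail_add_power_le[of n \<epsilon> B 0, OF \<epsilon> assms(3)] by simp
  have c_le: "c j + e j * B ^ j \<le> B ^ Suc n" if "j \<le> n" for j
    using digit_tail_add_power_le[of n \<epsilon> B "Suc j", OF \<epsilon> assms(3)] that c_step[OF that]
    by (simp add: c_def)
  have c_dvd: "B ^ j dvd c j" for j
    using power_dvd_digit_tail[of j j B n \<epsilon>] by (simp add: c_def)
  have "(0, 0) \<in> ?I" by (simp add: blocks_def e_def)
  then have ne: "?I \<noteq> {}" by blast
  have card: "card ?I = 1 + (\<Sum>j=0..n. B - 1 - \<epsilon> j)"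
    by (simp add: card_blocks e_def sum.distrib)
  have "sum ?\<delta> {..<?T 0} + sum ?\<delta> {?T 0..<B ^ Suc n} = sum ?\<delta> {..<B ^ Suc n}"
    using T_le by (simp only: lessThan_atLeast0 sum.atLeastLessThan_concat le0)
  moreover have "sum ?\<mu> ?I = sum ?\<delta> {?T 0..<B ^ Suc n}"
    using sum_blocks_ascending[of n c e B ?\<delta>, OF c_step] c_end by (simp add: c_def)
  ultimately have eq: "sum ?\<delta> {..<?T 0} = sum ?\<delta> {..<B ^ Suc n} - sum ?\<mu> ?I"
    by (metis add_diff_cancel)
  have "?\<mu> p \<in> emp_measures" if "p \<in> ?I" for p
    using assms(3) by (cases p) (auto simp: block_def intro!: sum_dirac_in_emp_measures)
  moreover have "sum ?\<delta> {..<B ^ Suc n} \<in> emp_measures"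
    using assms(3) by (intro sum_dirac_in_emp_measures) (auto simp: lessThan_empty_iff bot_nat_def)
  ultimately have "D (sum ?\<delta> {..<?T 0})
      \<le> f (1 + card ?I) * (D (sum ?\<delta> {..<B ^ Suc n}) + (\<Sum>p\<in>?I. D (?\<mu> p)))"
    unfolding eq by (rule f_subadditive_diff_sum_le[OF assms(1) finite_blocks ne])
  then have "ereal (D (sum ?\<delta> {..<?T 0})) \<le> ereal (f (1 + card ?I))
      * (ereal (D (sum ?\<delta> {..<B ^ Suc n})) + ereal (\<Sum>p\<in>?I. D (?\<mu> p)))"
    by simp
  also have "\<dots> \<le> ereal (f (1 + card ?I)) * (h (Suc n) + (\<Sum>j=0..n. ereal (real (e j)) * h j))"
  proof (intro ereal_mult_left_mono add_mono)
    show "ereal (D (sum ?\<delta> {..<B ^ Suc n})) \<le> h (Suc n)"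
      using h[of "Suc n" 0] by (simp add: lessThan_atLeast0)
    have "ereal (\<Sum>(j, k)\<in>?I. D (sum ?\<delta> (block B c j k))) \<le> (\<Sum>j=0..n. ereal (real (e j)) * h j)"
      by (rule sum_block_values_le[where M = "B ^ Suc n" and \<phi> = "\<lambda>A. D (sum ?\<delta> A)"])
        (use h c_dvd c_le in auto)
    then show "ereal (\<Sum>p\<in>?I. D (?\<mu> p)) \<le> (\<Sum>j=0..n. ereal (real (e j)) * h j)"
      by (simp add: case_prod_unfold)
    show "0 \<le> ereal (f (1 + card ?I))" using f by simp
  qed
  \<comment> \<open>The values \<open>h j\<close> may be infinite, so the law used is distributivity over nonnegative factors.\<close>
  also have "(\<Sum>j=0..n. ereal (real (e j)) * h j)
      = h 0 + (\<Sum>j=0..n. ereal (real (B - 1 - \<epsilon> j)) * h j)"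
  proof -
    have "ereal (real (e j)) * h j = (if j = 0 then h 0 else 0) + ereal (real (B - 1 - \<epsilon> j)) * h j" for j
    proof (cases "j = 0")
      case True
      have "ereal (real (e 0)) = ereal 1 + ereal (real (B - 1 - \<epsilon> 0))" by (simp add: e_def)
      then have "ereal (real (e 0)) * h 0 = ereal 1 * h 0 + ereal (real (B - 1 - \<epsilon> 0)) * h 0"
        by (simp only:) (rule ereal_left_distrib; simp)
      then show ?thesis using True by simp
    qed (simp add: e_def)
    then show ?thesis by (simp add: sum.distrib)
  qed
  finally show ?thesis using card by (simp add: add.assoc)
qed

text \<open>
  With the next lemma: as \<open>N\<close> has \<open>n + 1\<close> digits and is below \<open>b^(u d)\<close>, all levels up to \<open>n + 1\<close>
  are at most \<open>u\<close> and all indices below \<open>B^(n+1)\<close> belong to the segment.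
\<close>
lemma enat_less_seg_length:
  assumes "b > 1" "d > 0" "enat n < u" "i < (b ^ d) ^ Suc n"
  shows "enat i < seg_length b d u"
proof (cases u)
  case (enat k)
  then have "Suc n \<le> k" using assms(3) by simp
  then have "(b ^ d) ^ Suc n \<le> (b ^ d) ^ k" using assms(1) by (intro power_increasing) auto
  then show ?thesis using assms(4) enat
    by (simp add: seg_length_def power_mult[symmetric] mult.commute del: power_Suc)
qed (simp add: seg_length_def)

lemma enat_less_of_power_less_seg_length:
  assumes "b > 1" "d > 0" "(b ^ d) ^ n \<le> N" "enat N < seg_length b d u"
  shows "enat n < u"
proof (cases u)
  case (enat k)
  have "(b ^ d) ^ n < (b ^ d) ^ k"
    using assms(3,4) enat by (simp add: seg_length_def power_mult[symmetric] mult.commute)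
  moreover have "1 < b ^ d" using assms(1,2) by (rule one_less_power)
  ultimately have "n < k" by (simp only: power_strict_increasing_iff)
  then show ?thesis using enat by simp
qed simp

theorem theorem1:
  fixes b :: nat and u :: enat
    and P :: "real^'d \<Rightarrow> 'm"
    and D :: "('m set \<Rightarrow> real) \<Rightarrow> real" and f :: "nat \<Rightarrow> real"
    and L :: "nat \<Rightarrow> (real^'d) set set" and \<Z> :: "(nat \<Rightarrow> 'm) set"
    and N n :: nat and \<epsilon> :: "nat \<Rightarrow> nat"
  defines "d \<equiv> CARD('d)"
  defines "h \<equiv> h_sup D P b L"
  assumes "b > 1" and "u \<ge> 1"
    and "f_subadditive f D"
    and f_nonneg: "\<forall>k\<ge>1. 0 \<le> f k"
    and meanings:
      "((\<forall>m. enat m \<le> u \<longrightarrow> L m = {cube_lattice (b ^ m)}) \<and> \<Z> = box_segments b u P) \<or>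
       ((\<forall>m. enat m \<le> u \<longrightarrow> L m = {\<omega>. perturbed_lattice (b ^ m) \<omega>}) \<and> \<Z> = guided_segments b u P)"
    and "N \<ge> 1" and "enat N < seg_length b d u"
    and "N = (\<Sum>j=0..n. \<epsilon> j * b ^ (d * j))"
    and "\<forall>j\<le>n. \<epsilon> j \<le> b ^ d - 1" and "\<epsilon> n \<noteq> 0"
  shows
    "(\<forall>m k. enat m \<le> u \<longrightarrow> h m (enat k) \<le> h m \<infinity>) \<and>
     (\<forall>Z\<in>\<Z>.
        ereal (D (emp (first_elems N Z)))
          \<le> ereal (f (\<Sum>j=0..n. \<epsilon> j)) * (\<Sum>j=0..n. ereal (real (\<epsilon> j)) * h j (enat n)) \<and>
        ereal (f (\<Sum>j=0..n. \<epsilon> j)) * (\<Sum>j=0..n. ereal (real (\<epsilon> j)) * h j (enat n))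
          \<le> ereal (f (\<Sum>j=0..n. \<epsilon> j)) * (\<Sum>j=0..n. ereal (real (\<epsilon> j)) * h j \<infinity>)) \<and>
     int N = int (b ^ ((n + 1) * d)) - int (1 + (\<Sum>j=0..n. (b ^ d - 1 - \<epsilon> j) * b ^ (d * j))) \<and>
     (f_subadditive_diff f D \<longrightarrow>
       (\<forall>Z\<in>\<Z>.
          ereal (D (emp (first_elems N Z)))
            \<le> ereal (f (2 + (\<Sum>j=0..n. b ^ d - 1 - \<epsilon> j))) *
               (h (n + 1) (enat n) + h 0 (enat n)
                 + (\<Sum>j=0..n. ereal (real (b ^ d - 1 - \<epsilon> j)) * h j (enat n)))))"
proof -
  let ?B = "b ^ d"
  let ?L1 = "\<forall>m. enat m \<le> u \<longrightarrow> L m = {cube_lattice (b ^ m)}"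
  let ?L2 = "\<forall>m. enat m \<le> u \<longrightarrow> L m = {\<omega>. perturbed_lattice (b ^ m) \<omega>}"
  have B: "?B > 0" using assms(3) by simp
  have \<epsilon>: "\<epsilon> j \<le> ?B - 1" if "j \<le> n" for j using assms(11) that by blast
  have N: "N = digit_tail ?B n \<epsilon> 0" using assms(10) by (simp add: digit_tail_def power_mult)
  have "?B ^ n \<le> \<epsilon> n * ?B ^ n" using assms(12) by simp
  also have "\<dots> \<le> N" unfolding N digit_tail_def
    by (rule member_le_sum[where f = "\<lambda>j. \<epsilon> j * ?B ^ j"]) auto
  finally have nu: "enat n < u"
    using enat_less_of_power_less_seg_length[OF assms(3) _ _ assms(9)] by (simp add: d_def)
  then have nu': "enat j \<le> u" if "j \<le> Suc n" for j
    using that by (metis Suc_ile_eq enat_ord_simps(1) order_trans)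
  have h_mono: "h m (enat k) \<le> h m \<infinity>" for m k
    unfolding h_def by (rule h_sup_le_infinity)
  have bound: "ereal (D (\<Sum>i\<in>{A..<A + ?B ^ j}. dirac (Z i))) \<le> h j (enat n)"
    if Z: "Z \<in> \<Z>" and j: "j \<le> Suc n" and A: "?B ^ j dvd A" "A + ?B ^ j \<le> ?B ^ Suc n" for Z j A
  proof -
    \<comment> \<open>In both meanings the values of \<open>Z\<close> are \<open>P\<close> along a sequence \<open>x\<close> whose blocks are translates of members of \<open>L j\<close>.\<close>
    obtain x where Zx: "Z = init_seg (seg_length b d u) (P \<circ> x)"
      and block: "\<exists>(\<omega>, v)\<in>Omega b L j (enat n).
        image_mset x (mset_set {A..<A + ?B ^ j}) = mset_set ((+) v ` \<omega>)"
      using meanings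
    proof (elim disjE conjE)
      assume L: ?L1 and "\<Z> = box_segments b u P"
      then obtain s where "Z = init_seg (seg_length b d u) (P \<circ> s)" "box_seq b s"
        using Z by (auto simp: box_segments_def d_def)
      then show thesis
        using that box_seq_block[of b s L j n A] assms(3) L nu'[OF j] j A
        unfolding d_def by blast
    next
      assume L: ?L2 and "\<Z> = guided_segments b u P"
      then obtain s q where "Z = init_seg (seg_length b d u) (P \<circ> q)" "box_seq b s" "guided_seq b s q"
        using Z by (auto simp: guided_segments_def d_def)
      then show thesis
        using that guided_seq_block[of b s q L j A n] assms(3) L nu'[OF j] A
        unfolding d_def by blast
    qed
    have "Z i = (P \<circ> x) i" if "i \<in> {A..<A + ?B ^ j}" for i
    proof -
      have "i < ?B ^ Suc n" using that A(2) by simp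
      then have "enat i < seg_length b d u"
        using enat_less_seg_length[OF assms(3) _ nu] by (simp add: d_def)
      then show ?thesis by (simp add: Zx init_seg_def)
    qed
    then have "(\<Sum>i\<in>{A..<A + ?B ^ j}. dirac (Z i)) = (\<Sum>i\<in>{A..<A + ?B ^ j}. dirac ((P \<circ> x) i))"
      by (intro sum.cong) auto
    then show ?thesis
      unfolding h_def using block_value_le_h_sup[OF block, of D P]
      by (simp only: emp_image_mset_set)
  qed
  have emp: "emp (first_elems N Z) = (\<Sum>i<digit_tail ?B n \<epsilon> 0. dirac (Z i))" for Z :: "nat \<Rightarrow> 'm"
    unfolding first_elems_def emp_image_mset_set N ..
  have "0 \<le> f (\<Sum>j=0..n. \<epsilon> j)"
  proof -
    have "\<epsilon> n \<le> (\<Sum>j=0..n. \<epsilon> j)" by (rule member_le_sum) auto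
    then show ?thesis using f_nonneg assms(12) by simp
  qed
  then have "ereal (f (\<Sum>j=0..n. \<epsilon> j)) * (\<Sum>j=0..n. ereal (real (\<epsilon> j)) * h j (enat n))
      \<le> ereal (f (\<Sum>j=0..n. \<epsilon> j)) * (\<Sum>j=0..n. ereal (real (\<epsilon> j)) * h j \<infinity>)"
    by (intro ereal_mult_left_mono sum_mono h_mono) auto
  moreover have "ereal (D (emp (first_elems N Z)))
      \<le> ereal (f (\<Sum>j=0..n. \<epsilon> j)) * (\<Sum>j=0..n. ereal (real (\<epsilon> j)) * h j (enat n))" if "Z \<in> \<Z>" for Z
    unfolding emp
    by (rule digit_block_estimate[where \<epsilon> = \<epsilon> and h = "\<lambda>j. h j (enat n)",
      OF assms(5) f_nonneg B \<epsilon> assms(12) bound[OF that]])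
  moreover have "ereal (D (emp (first_elems N Z)))
      \<le> ereal (f (2 + (\<Sum>j=0..n. b ^ d - 1 - \<epsilon> j))) *
         (h (n + 1) (enat n) + h 0 (enat n)
           + (\<Sum>j=0..n. ereal (real (b ^ d - 1 - \<epsilon> j)) * h j (enat n)))"
    if "f_subadditive_diff f D" "Z \<in> \<Z>" for Z
    unfolding emp Suc_eq_plus1[symmetric]
    by (rule complementary_digit_block_estimate[where \<epsilon> = \<epsilon> and h = "\<lambda>j. h j (enat n)",
      OF that(1) f_nonneg B \<epsilon> bound[OF that(2)]])
  moreover have "int N = int (b ^ ((n + 1) * d)) - int (1 + (\<Sum>j=0..n. (b ^ d - 1 - \<epsilon> j) * b ^ (d * j)))"
  proof -
    have "b ^ ((n + 1) * d) = ?B ^ Suc n" by (simp only: Suc_eq_plus1 mult.commute[of _ d] power_mult)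
    then have "N + (1 + (\<Sum>j=0..n. (b ^ d - 1 - \<epsilon> j) * b ^ (d * j))) = b ^ ((n + 1) * d)"
      using digit_tail_complement_sum[OF \<epsilon> B] unfolding N power_mult by simp
    then show ?thesis by linarith
  qed
  ultimately show ?thesis using h_mono by blast
qed

end
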